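(* Let $A$ be a linear relation in a linear space $\mathfrak{H}$ over $\mathbb{C}$ and let $\{\lambda_1,\ldots,\lambda_l\}$ and $\{\mu_1,\ldots,\mu_m\}$ (with $l,m\ge1$) be two disjoint subsets of $\mathbb{C}\cup\{\infty\}$. Then $$\mathfrak{R}_c(A)=\left(\sum_{i=1}^l\mathfrak{R}_{\lambda_i}(A)\right)\cap\left(\sum_{j=1}^m\mathfrak{R}_{\mu_j}(A)\right).$$
   Context: Let $\mathfrak{H}$ be a (possibly infinite-dimensional) linear space over $\mathbb{C}$. A linear relation $A$ in $\mathfrak{H}$ is a linear subspace of $\mathfrak{H}\times\mathfrak{H}$. Put $\ker A=\{x: (x,0)\in A\}$, $\operatorname{mul}A=\{y:(0,y)\in A\}$. For $\lambda\in\mathbb{C}$, $A-\lambda=\{(x,y-\lambda x):(x,y)\in A\}$. The product of linear relations is $AB=\{(x,y): \exists z\in\mathfrak{H},\ (x,z)\in B,\ (z,y)\in A\}$, and $A^k=AA^{k-1}$ for $k\ge1$ with $A^0=I$. The root spaces are the linear subspaces $$\mathfrak{R}_\lambda(A)=\bigcup_{i=1}^\infty\ker(A-\lambda)^i\ (\lambda\in\mathbb{C}),\qquad \mathfrak{R}_\infty(A)=\bigcup_{i=1}^\infty\operatorname{mul}A^i,$$ and the singular chain space is $\mathfrak{R}_c(A)=\mathfrak{R}_0(A)\cap\mathfrak{R}_\infty(A)$. Sums of root spaces are sums of linear subspaces (not necessarily direct). *)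

theory Defs
  imports "HOL-Analysis.Product_Vector" "HOL-Library.Set_Algebras"
begin

text \<open>
  A complex linear space is a type of class \<open>ab_group_add\<close> with a scalar multiplication \<open>smul\<close>
  satisfying \<open>vector_space smul\<close>. Products of relations are taken in the order
  \<open>AB = {(x, y). \<exists>z. (x, z) \<in> B \<and> (z, y) \<in> A}\<close>, which is \<open>B O A\<close>; the powers \<open>A ^^ k\<close> below are
  those of relations, with \<open>A ^^ 0 = Id\<close> and \<open>A ^^ Suc k = (A ^^ k) O A\<close>.
  Sums of subspaces are elementwise sums of sets, as in \<open>HOL-Library.Set_Algebras\<close>.
\<close>

definition linear_relation ::
    "(complex \<Rightarrow> 'a \<Rightarrow> 'a) \<Rightarrow> ('a::ab_group_add \<times> 'a) set \<Rightarrow> bool" where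
  "linear_relation smul A \<longleftrightarrow> module.subspace (module_prod.scale smul smul) A"

lemma linear_relation_iff:
  assumes "vector_space smul"
  shows "linear_relation smul A \<longleftrightarrow>
    (0, 0) \<in> A \<and>
    (\<forall>x y u v. (x, y) \<in> A \<longrightarrow> (u, v) \<in> A \<longrightarrow> (x + u, y + v) \<in> A) \<and>
    (\<forall>c x y. (x, y) \<in> A \<longrightarrow> (smul c x, smul c y) \<in> A)"
proof -
  interpret vector_space smul by fact
  interpret vector_space_prod smul smul ..
  show ?thesis
    unfolding linear_relation_def p.subspace_def
    by (simp add: split_paired_Ball_Sigma Ball_def scale_prod zero_prod_def)
qed

definition rel_ker :: "('a::zero \<times> 'a) set \<Rightarrow> 'a set" where
  "rel_ker A = {x. (x, 0) \<in> A}"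

definition rel_mul :: "('a::zero \<times> 'a) set \<Rightarrow> 'a set" where
  "rel_mul A = {y. (0, y) \<in> A}"

definition rel_shift ::
    "(complex \<Rightarrow> 'a \<Rightarrow> 'a) \<Rightarrow> ('a::ab_group_add \<times> 'a) set \<Rightarrow> complex \<Rightarrow> ('a \<times> 'a) set" where
  "rel_shift smul A lam = {(x, y - smul lam x) | x y. (x, y) \<in> A}"

datatype ext_complex = Finite complex | Infty

fun root_space ::
    "(complex \<Rightarrow> 'a \<Rightarrow> 'a) \<Rightarrow> ('a::ab_group_add \<times> 'a) set \<Rightarrow> ext_complex \<Rightarrow> 'a set" where
  "root_space smul A (Finite lam) = (\<Union>i\<in>{1::nat..}. rel_ker (rel_shift smul A lam ^^ i))"
| "root_space smul A Infty = (\<Union>i\<in>{1::nat..}. rel_mul (A ^^ i))"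

definition singular_chain_space ::
    "(complex \<Rightarrow> 'a \<Rightarrow> 'a) \<Rightarrow> ('a::ab_group_add \<times> 'a) set \<Rightarrow> 'a set" where
  "singular_chain_space smul A = root_space smul A (Finite 0) \<inter> root_space smul A Infty"

end

theory Submission
  imports Defs
begin

text \<open>
  Every root space is a space of vectors that are joined to \<open>0\<close> by a finite path: along \<open>A\<close>,
  starting at \<open>0\<close>, for the point \<open>\<infinity>\<close>, and along \<open>A - \<lambda>\<close>, ending at \<open>0\<close>, for the point \<open>\<lambda>\<close>.
  This makes \<open>\<R>\<^sub>\<infinity>\<close> the least subspace that \<open>A\<close> maps into itself, and \<open>A - \<lambda>\<close> has the same
  \<open>\<R>\<^sub>\<infinity>\<close> as \<open>A\<close>. It contains the multivalued part of \<open>A\<close>, so modulo \<open>\<R>\<^sub>\<infinity>\<close> the relation \<open>A\<close>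
  is a single-valued operator, and the usual argument for operators shows that root
  vectors for distinct finite points are linearly independent modulo \<open>\<R>\<^sub>\<infinity>\<close>
  (\<open>root_vectors_independent\<close>).

  The second ingredient is that \<open>\<R>\<^sub>\<lambda> \<inter> \<R>\<^sub>\<infinity>\<close> is the same space for all finite \<open>\<lambda>\<close>, hence equal to
  \<open>\<R>\<^sub>c\<close> (\<open>root_inter_Infty\<close>). The reason is dual to the first one: modulo \<open>\<R>\<^sub>\<lambda>\<close> the
  relation \<open>B = (A - \<lambda>)\<^sup>-\<^sup>1\<close> is a single-valued operator, for which \<open>\<R>\<^sub>0\<close> and \<open>\<R>\<^sub>\<infinity>\<close> consist of
  root vectors at the distinct points \<open>-1/\<lambda>\<close> and \<open>0\<close> if \<open>\<lambda> \<noteq> 0\<close>.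

  Together they say that if root vectors at distinct points of \<open>\<complex> \<union> {\<infinity>}\<close> add up to zero, then
  all of them lie in \<open>\<R>\<^sub>c\<close>. Writing a vector of the intersection in two ways and subtracting
  gives such a relation. In the other direction, \<open>\<R>\<^sub>c\<close> is contained in every single root space.
\<close>

section \<open>Spaces reachable from zero\<close>

definition reach :: "('a::zero \<times> 'a) set \<Rightarrow> 'a set" where
  "reach C = {y. (0, y) \<in> C\<^sup>*}"

lemma zero_in_reach: "0 \<in> reach C"
  by (simp add: reach_def)

lemma reach_step: "x \<in> reach C \<Longrightarrow> (x, y) \<in> C \<Longrightarrow> y \<in> reach C"
  unfolding reach_def by (simp add: rtrancl.rtrancl_into_rtrancl)

lemma reach_induct [consumes 1, case_names zero step]:
  assumes "x \<in> reach C" and "P 0"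
    and "\<And>x y. x \<in> reach C \<Longrightarrow> (x, y) \<in> C \<Longrightarrow> P x \<Longrightarrow> P y"
  shows "P x"
proof -
  have "(0, x) \<in> C\<^sup>*"
    using assms(1) by (simp add: reach_def)
  then show ?thesis
    by (induction rule: rtrancl_induct) (use assms in \<open>auto simp: reach_def\<close>)
qed

lemma ex_relpow_iff_trancl: "(\<exists>i\<in>{1::nat..}. p \<in> C ^^ i) \<longleftrightarrow> p \<in> C\<^sup>+"
  by (auto simp: trancl_power Suc_le_eq)

lemma UN_rel_mul_eq_reach:
  assumes "(0, 0) \<in> C"
  shows "(\<Union>i\<in>{1::nat..}. rel_mul (C ^^ i)) = reach C"
proof -
  have "(\<Union>i\<in>{1::nat..}. rel_mul (C ^^ i)) = {y. (0, y) \<in> C\<^sup>+}"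
    unfolding rel_mul_def ex_relpow_iff_trancl[symmetric] by blast
  also have "\<dots> = reach C"
    using assms by (auto simp: reach_def rtrancl_eq_or_trancl)
  finally show ?thesis .
qed

lemma UN_rel_ker_eq_reach:
  assumes "(0, 0) \<in> C"
  shows "(\<Union>i\<in>{1::nat..}. rel_ker (C ^^ i)) = reach (C\<inverse>)"
proof -
  have "(\<Union>i\<in>{1::nat..}. rel_ker (C ^^ i)) = {x. (x, 0) \<in> C\<^sup>+}"
    unfolding rel_ker_def ex_relpow_iff_trancl[symmetric] by blast
  also have "\<dots> = reach (C\<inverse>)"
    using assms by (auto simp: reach_def rtrancl_converse rtrancl_eq_or_trancl)
  finally show ?thesis .
qed

lemma rel_shift_iff:
  "(x, y) \<in> rel_shift smul A lam \<longleftrightarrow> (x, y + smul lam x) \<in> A"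
  by (force simp: rel_shift_def)

locale complex_linear_space = vector_space smul
  for smul :: "complex \<Rightarrow> 'a \<Rightarrow> 'a::ab_group_add"
begin

lemma
  assumes "linear_relation smul C"
  shows linear_relation_zero: "(0, 0) \<in> C"
    and linear_relation_add: "(x, y) \<in> C \<Longrightarrow> (u, v) \<in> C \<Longrightarrow> (x + u, y + v) \<in> C"
    and linear_relation_scale: "(x, y) \<in> C \<Longrightarrow> (smul c x, smul c y) \<in> C"
  using assms unfolding linear_relation_iff[OF vector_space_axioms] by blast+

lemma linear_relation_sum:
  assumes "linear_relation smul C" and "\<And>i. i \<in> I \<Longrightarrow> (f i, g i) \<in> C"
  shows "(sum f I, sum g I) \<in> C"
  using assms(2)
  by (induction I rule: infinite_finite_induct)
    (auto simp: linear_relation_zero[OF assms(1)] intro: linear_relation_add[OF assms(1)])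

lemma linear_relation_converse:
  assumes "linear_relation smul C"
  shows "linear_relation smul (C\<inverse>)"
  using assms by (simp add: linear_relation_iff[OF vector_space_axioms])

lemma linear_relation_shift:
  assumes "linear_relation smul A"
  shows "linear_relation smul (rel_shift smul A lam)"
proof -
  have "(x + u, y + v) \<in> rel_shift smul A lam"
    if "(x, y) \<in> rel_shift smul A lam" "(u, v) \<in> rel_shift smul A lam" for x y u v
    using linear_relation_add[OF assms, of x "y + smul lam x" u "v + smul lam u"] that
    by (simp add: rel_shift_iff algebra_simps)
  moreover have "(smul c x, smul c y) \<in> rel_shift smul A lam"
    if "(x, y) \<in> rel_shift smul A lam" for c x y
    using linear_relation_scale[OF assms, of x "y + smul lam x" c] that
    by (simp add: rel_shift_iff scale_right_distrib mult.commute)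
  ultimately show ?thesis
    using linear_relation_zero[OF assms]
    by (simp add: linear_relation_iff[OF vector_space_axioms] rel_shift_iff)
qed

lemma shift_shift_uminus: "rel_shift smul (rel_shift smul A lam) (- lam) = A"
  by (auto simp: rel_shift_iff)

lemma shift_zero: "rel_shift smul A 0 = A"
  by (auto simp: rel_shift_iff)

text \<open>
  Two paths from \<open>0\<close> can be added once they have the same length, and this can be arranged
  because a path may stay at \<open>0\<close> for any number of steps before it leaves.
\<close>

lemma subspace_reach:
  assumes C: "linear_relation smul C"
  shows "subspace (reach C)"
proof (rule subspaceI)
  show "0 \<in> reach C"
    by (rule zero_in_reach)
next
  fix x y assume "x \<in> reach C" "y \<in> reach C"
  then obtain m n where m: "(0, x) \<in> C ^^ m" and n: "(0, y) \<in> C ^^ n"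
    by (auto simp: reach_def dest!: rtrancl_imp_relpow)
  have wait: "(0, 0) \<in> C ^^ k" for k
    by (induction k) (use linear_relation_zero[OF C] in auto)
  have x: "(0, x) \<in> C ^^ (n + m)"
    unfolding relpow_add using wait m by blast
  have y: "(0, y) \<in> C ^^ (n + m)"
    unfolding add.commute[of n] relpow_add using wait n by blast
  have "(a + c, b + d) \<in> C ^^ k" if "(a, b) \<in> C ^^ k" "(c, d) \<in> C ^^ k" for a b c d k
    using that
  proof (induction k arbitrary: b d)
    case (Suc k)
    then show ?case
      by (fastforce intro: linear_relation_add[OF C])
  qed simp
  from this[OF x y] show "x + y \<in> reach C"
    by (auto simp: reach_def dest: relpow_imp_rtrancl)
next
  fix c x assume "x \<in> reach C"
  then show "smul c x \<in> reach C"
    by (induction rule: reach_induct)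
      (auto simp: zero_in_reach intro: reach_step linear_relation_scale[OF C])
qed

lemma subspace_scaleD:
  assumes "subspace V" "smul c x \<in> V" "c \<noteq> 0"
  shows "x \<in> V"
  using subspace_scale[OF assms(1,2), of "inverse c"] assms(3) by simp

lemma subspace_add_iff:
  assumes "subspace V" "x \<in> V"
  shows "x + y \<in> V \<longleftrightarrow> y \<in> V" and "y + x \<in> V \<longleftrightarrow> y \<in> V"
  using assms subspace_add[of V x y] subspace_diff[of V "x + y" x] by (auto simp: add.commute)

lemma reach_shift_step:
  assumes A: "linear_relation smul A" and "x \<in> reach A" "(x, y) \<in> rel_shift smul A mu"
  shows "y \<in> reach A"
  using reach_step[OF assms(2), of "y + smul mu x"] assms(3)
    subspace_add_iff[OF subspace_reach[OF A] subspace_scale[OF subspace_reach[OF A] assms(2)]]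
  by (simp add: rel_shift_iff)

text \<open>
  A subspace that is mapped into itself by \<open>A\<close> is also mapped into itself by \<open>A - \<lambda>\<close>.
\<close>

lemma reach_shift:
  assumes A: "linear_relation smul A"
  shows "reach (rel_shift smul A lam) = reach A"
proof -
  have "x \<in> reach C"
    if "linear_relation smul C" "x \<in> reach (rel_shift smul C mu)" for C mu x
    using that(2)
    by (induction rule: reach_induct) (auto simp: zero_in_reach intro: reach_shift_step[OF that(1)])
  from this[OF A] this[OF linear_relation_shift[OF A, of lam], where mu = "- lam"]
  show ?thesis
    by (auto simp: shift_shift_uminus)
qed

section \<open>Root spaces\<close>

lemma root_space_Infty:
  assumes "linear_relation smul A"
  shows "root_space smul A Infty = reach A"
  using UN_rel_mul_eq_reach[OF linear_relation_zero[OF assms]] by simp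

lemma root_space_Finite:
  assumes "linear_relation smul A"
  shows "root_space smul A (Finite lam) = reach ((rel_shift smul A lam)\<inverse>)"
  using UN_rel_ker_eq_reach[OF linear_relation_zero[OF linear_relation_shift[OF assms]]] by simp

lemma subspace_root_space:
  assumes "linear_relation smul A"
  shows "subspace (root_space smul A nu)"
  by (cases nu)
    (simp_all only: root_space_Infty[OF assms] root_space_Finite[OF assms] assms
      subspace_reach linear_relation_converse linear_relation_shift)

lemma subspace_singular_chain_space:
  assumes "linear_relation smul A"
  shows "subspace (singular_chain_space smul A)"
  unfolding singular_chain_space_def
  by (intro subspace_inter subspace_root_space assms)

lemma root_space_Finite_pred:
  assumes A: "linear_relation smul A"
    and "y \<in> root_space smul A (Finite lam)" "(x, y) \<in> rel_shift smul A lam"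
  shows "x \<in> root_space smul A (Finite lam)"
  using assms(2,3) unfolding root_space_Finite[OF A] by (blast intro: reach_step)

lemma root_space_Finite_succ:
  assumes A: "linear_relation smul A" and "x \<in> root_space smul A (Finite lam)"
  shows "\<exists>y. (x, y) \<in> rel_shift smul A lam \<and> y \<in> root_space smul A (Finite lam)"
  using assms(2) unfolding root_space_Finite[OF A]
  by (cases rule: reach_induct[consumes 1, case_names zero step])
    (use linear_relation_zero[OF linear_relation_shift[OF A]] zero_in_reach in blast)+

section \<open>Root vectors at distinct finite points\<close>

text \<open>
  On the root space at \<open>\<mu>\<close> the operator induced by \<open>A - \<mu>\<close> modulo \<open>\<R>\<^sub>\<infinity>\<close> is locally nilpotent;
  therefore adding a nonzero scalar \<open>c\<close> to it gives an injective operator.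
\<close>

lemma nilpotent_plus_scalar_injective:
  assumes A: "linear_relation smul A"
    and z': "z' \<in> root_space smul A (Finite mu)"
    and "(z, z') \<in> rel_shift smul A mu" "c \<noteq> 0" "smul c z + z' \<in> reach A"
  shows "z \<in> reach A"
  using z'[unfolded root_space_Finite[OF A]] assms(3,5)
proof (induction arbitrary: z rule: reach_induct)
  case zero
  then show ?case
    using subspace_scaleD[OF subspace_reach[OF A]] \<open>c \<noteq> 0\<close> by simp
next
  case (step z'' z')
  have "(smul c z + z', smul c z' + z'') \<in> rel_shift smul A mu"
    using step.hyps step.prems
    by (intro linear_relation_add linear_relation_scale linear_relation_shift A) auto
  then have "smul c z' + z'' \<in> reach A"
    using reach_shift_step[OF A] step.prems by blast
  then have "z' \<in> reach A"
    using step.IH step.hyps by blast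
  then have "smul c z \<in> reach A"
    using step.prems subspace_add_iff(2)[OF subspace_reach[OF A]] by blast
  then show ?case
    using subspace_scaleD[OF subspace_reach[OF A]] \<open>c \<noteq> 0\<close> by blast
qed

text \<open>
  The classical argument for operators, modulo \<open>\<R>\<^sub>\<infinity>\<close>: applying \<open>A - \<nu>\<close> to a vanishing sum of
  root vectors shortens the path of the vector at \<open>\<nu>\<close> and changes every other one only by an injective map
  of its own root space. So the vector at \<open>\<nu>\<close> can be removed.
\<close>

lemma root_vectors_independent:
  assumes A: "linear_relation smul A" and "finite S"
    and "\<And>mu. mu \<in> S \<Longrightarrow> z mu \<in> root_space smul A (Finite mu)"
    and "(\<Sum>mu\<in>S. z mu) \<in> reach A"
    and "mu \<in> S"
  shows "z mu \<in> reach A"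
  using assms(2-)
proof (induction S arbitrary: z mu rule: finite_induct)
  case (insert nu S)
  have *: "(\<forall>mu\<in>S. z mu \<in> reach A) \<and> x \<in> reach A"
    if "x \<in> reach ((rel_shift smul A nu)\<inverse>)"
      and "\<And>mu. mu \<in> S \<Longrightarrow> z mu \<in> root_space smul A (Finite mu)"
      and "x + (\<Sum>mu\<in>S. z mu) \<in> reach A" for x z
    using that
  proof (induction arbitrary: z rule: reach_induct)
    case zero
    then show ?case
      using insert.IH[of z] by (simp add: zero_in_reach)
  next
    case (step x' x)
    have "\<forall>mu\<in>S. \<exists>y. (z mu, y) \<in> rel_shift smul A mu \<and> y \<in> root_space smul A (Finite mu)"
      using root_space_Finite_succ[OF A step.prems(1)] by blast
    from bchoice[OF this] obtain z' where z': "\<And>mu. mu \<in> S \<Longrightarrow> (z mu, z' mu) \<in> rel_shift smul A mu"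
      "\<And>mu. mu \<in> S \<Longrightarrow> z' mu \<in> root_space smul A (Finite mu)"
      by blast
    define w where "w mu = smul (mu - nu) (z mu) + z' mu" for mu
    have "(z mu, w mu) \<in> rel_shift smul A nu" if "mu \<in> S" for mu
      using z'(1)[OF that] by (simp add: rel_shift_iff w_def algebra_simps)
    then have "(x + (\<Sum>mu\<in>S. z mu), x' + (\<Sum>mu\<in>S. w mu)) \<in> rel_shift smul A nu"
      using step.hyps
      by (intro linear_relation_add linear_relation_sum linear_relation_shift A) auto
    then have "x' + (\<Sum>mu\<in>S. w mu) \<in> reach A"
      using reach_shift_step[OF A] step.prems by blast
    moreover have "w mu \<in> root_space smul A (Finite mu)" if "mu \<in> S" for mu
      unfolding w_def using z'(2)[OF that] step.prems(1)[OF that]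
      by (intro subspace_add subspace_scale subspace_root_space A)
    ultimately have w: "w mu \<in> reach A" if "mu \<in> S" for mu
      using step.IH that by blast
    have z: "z mu \<in> reach A" if "mu \<in> S" for mu
    proof (rule nilpotent_plus_scalar_injective[OF A])
      show "mu - nu \<noteq> 0"
        using that insert.hyps by auto
    qed (use z' w that in \<open>auto simp: w_def\<close>)
    then have "(\<Sum>mu\<in>S. z mu) \<in> reach A"
      by (intro subspace_sum subspace_reach A)
    then show ?case
      using z step.prems(2) subspace_add_iff(2)[OF subspace_reach[OF A]] by blast
  qed
  have "z nu \<in> reach ((rel_shift smul A nu)\<inverse>)"
    using insert.prems(1)[of nu] unfolding root_space_Finite[OF A] by blast
  from *[OF this, of z] show ?case
    using insert.prems insert.hyps by auto
qed simp

section \<open>The singular chain space\<close>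

text \<open>
  Let \<open>B = (A - \<lambda>)\<^sup>-\<^sup>1\<close>, a single-valued operator modulo \<open>\<R>\<^sub>\<lambda>\<close>. If \<open>A\<close> maps \<open>x\<close> into \<open>\<R>\<^sub>\<lambda>\<close>, then
  \<open>B x = -x/\<lambda>\<close> modulo \<open>\<R>\<^sub>\<lambda>\<close>, whereas \<open>x \<in> \<R>\<^sub>\<infinity>\<close> says that some power of \<open>B\<close> annihilates \<open>x\<close>.
\<close>

lemma root_space_Finite_of_image:
  assumes A: "linear_relation smul A" and "lam \<noteq> 0" and "x \<in> reach A"
    and "(x, x') \<in> A" "x' \<in> root_space smul A (Finite lam)"
  shows "x \<in> root_space smul A (Finite lam)"
proof -
  let ?R = "root_space smul A (Finite lam)"
  note R = subspace_root_space[OF A, of "Finite lam"]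
  have "x \<in> reach (rel_shift smul A lam)"
    using assms(3) reach_shift[OF A] by blast
  then show ?thesis
    using assms(4,5)
  proof (induction arbitrary: x' rule: reach_induct)
    case zero
    show ?case
      using subspace_0[OF R] .
  next
    case (step w x)
    (* With B as above, w = B x, so w + x/lam must be zero, both modulo R. *)
    have "(x, x' - smul lam x) \<in> rel_shift smul A lam"
      using step.prems by (simp add: rel_shift_iff)
    then have "(smul (1 / lam) x, smul (1 / lam) (x' - smul lam x)) \<in> rel_shift smul A lam"
      by (intro linear_relation_scale linear_relation_shift A)
    from linear_relation_add[OF linear_relation_shift[OF A] step.hyps(2) this]
    have "(w + smul (1 / lam) x, smul (1 / lam) x') \<in> rel_shift smul A lam"
      using \<open>lam \<noteq> 0\<close> by (simp add: scale_right_diff_distrib)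
    then have u: "w + smul (1 / lam) x \<in> ?R"
      using root_space_Finite_pred[OF A] subspace_scale[OF R] step.prems by blast
    then have "smul lam (w + smul (1 / lam) x) \<in> ?R"
      by (rule subspace_scale[OF R])
    then have "x + smul lam w \<in> ?R"
      using \<open>lam \<noteq> 0\<close> by (simp add: scale_right_distrib add.commute)
    moreover have "(w, x + smul lam w) \<in> A"
      using step.hyps by (simp add: rel_shift_iff)
    ultimately have "w \<in> ?R"
      using step.IH by blast
    then have "smul (1 / lam) x \<in> ?R"
      using u subspace_add_iff(1)[OF R] by blast
    then show ?case
      using subspace_scaleD[OF R] \<open>lam \<noteq> 0\<close> by simp
  qed
qed

lemma singular_chain_subset_root_Finite:
  assumes A: "linear_relation smul A"
  shows "singular_chain_space smul A \<subseteq> root_space smul A (Finite lam)"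
proof (cases "lam = 0")
  case True
  then show ?thesis
    unfolding singular_chain_space_def by blast
next
  case False
  have "x \<in> root_space smul A (Finite lam)" if "x \<in> reach (A\<inverse>)" "x \<in> reach A" for x
    using that
  proof (induction rule: reach_induct)
    case zero
    show ?case
      using subspace_0[OF subspace_root_space[OF A]] .
  next
    case (step x' x)
    then show ?case
      using root_space_Finite_of_image[OF A False] reach_step by blast
  qed
  then show ?thesis
    unfolding singular_chain_space_def root_space_Infty[OF A] root_space_Finite[OF A, of 0]
      shift_zero by blast
qed

text \<open>
  The inclusion from left to right is the preceding lemma for \<open>A - \<lambda>\<close> and the point \<open>-\<lambda>\<close>, since
  the root space of \<open>A\<close> at \<open>\<lambda>\<close> is that of \<open>A - \<lambda>\<close> at \<open>0\<close>.
\<close>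

lemma root_inter_Infty:
  assumes A: "linear_relation smul A"
  shows "root_space smul A (Finite lam) \<inter> root_space smul A Infty = singular_chain_space smul A"
proof
  let ?B = "rel_shift smul A lam"
  note B = linear_relation_shift[OF A, of lam]
  have "root_space smul A (Finite lam) \<inter> root_space smul A Infty = singular_chain_space smul ?B"
    unfolding singular_chain_space_def root_space_Infty[OF A] root_space_Infty[OF B]
      root_space_Finite[OF A] root_space_Finite[OF B] shift_zero reach_shift[OF A] ..
  also have "\<dots> \<subseteq> root_space smul ?B (Finite (- lam))"
    by (rule singular_chain_subset_root_Finite[OF B])
  also have "\<dots> = root_space smul A (Finite 0)"
    unfolding root_space_Finite[OF A] root_space_Finite[OF B] shift_shift_uminus shift_zero ..
  finally show "root_space smul A (Finite lam) \<inter> root_space smul A Infty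
      \<subseteq> singular_chain_space smul A"
    unfolding singular_chain_space_def by blast
next
  show "singular_chain_space smul A \<subseteq> root_space smul A (Finite lam) \<inter> root_space smul A Infty"
    using singular_chain_subset_root_Finite[OF A] unfolding singular_chain_space_def by blast
qed

lemma singular_chain_subset_root:
  assumes A: "linear_relation smul A"
  shows "singular_chain_space smul A \<subseteq> root_space smul A nu"
  using root_inter_Infty[OF A] by (cases nu) blast+

text \<open>
  A vanishing sum puts the sum of its finite part into \<open>\<R>\<^sub>\<infinity>\<close>. Independence modulo \<open>\<R>\<^sub>\<infinity>\<close> then
  handles the vectors at finite points, and the vector at \<open>\<infinity>\<close>, if there is one, is minus
  their sum.
\<close>

lemma root_vectors_sum_zero:
  assumes A: "linear_relation smul A" and S: "finite S"
    and z: "\<And>nu. nu \<in> S \<Longrightarrow> z nu \<in> root_space smul A nu"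
    and zero: "(\<Sum>nu\<in>S. z nu) = 0" and "nu \<in> S"
  shows "z nu \<in> singular_chain_space smul A"
proof -
  define P where "P = {mu. Finite mu \<in> S}"
  have P: "Finite ` P = S - {Infty}"
    unfolding P_def by (auto intro: ext_complex.exhaust)
  have "inj_on Finite P"
    by (auto intro: inj_onI)
  then have "finite P"
    using P S by (metis finite_Diff finite_imageD)
  have sum_P: "(\<Sum>mu\<in>P. z (Finite mu)) = (\<Sum>nu\<in>S - {Infty}. z nu)"
    using sum.reindex[OF \<open>inj_on Finite P\<close>, of z] P by simp
  have split: "(\<Sum>nu\<in>S - {Infty}. z nu) = - z Infty" if "Infty \<in> S"
    using sum.remove[OF S that, of z] zero by (simp add: eq_neg_iff_add_eq_0 add.commute)
  have "(\<Sum>mu\<in>P. z (Finite mu)) \<in> reach A"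
  proof (cases "Infty \<in> S")
    case True
    then have "z Infty \<in> reach A"
      using z root_space_Infty[OF A] by blast
    then show ?thesis
      unfolding sum_P split[OF True] by (rule subspace_neg[OF subspace_reach[OF A]])
  next
    case False
    then show ?thesis
      using zero sum_P zero_in_reach by simp
  qed
  then have "z (Finite mu) \<in> reach A" if "mu \<in> P" for mu
    using root_vectors_independent[OF A \<open>finite P\<close>, of "\<lambda>mu. z (Finite mu)"] z that
    unfolding P_def by blast
  then have fin: "z (Finite mu) \<in> singular_chain_space smul A" if "mu \<in> P" for mu
    using z[of "Finite mu"] that root_inter_Infty[OF A, of mu] root_space_Infty[OF A]
    unfolding P_def by blast
  show ?thesis
  proof (cases nu)
    case (Finite mu)
    then show ?thesis
      using fin \<open>nu \<in> S\<close> unfolding P_def by blast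
  next
    case Infty
    have "(\<Sum>mu\<in>P. z (Finite mu)) \<in> singular_chain_space smul A"
      using fin by (intro subspace_sum subspace_singular_chain_space A)
    then have "- z Infty \<in> singular_chain_space smul A"
      using split sum_P Infty \<open>nu \<in> S\<close> by simp
    then show ?thesis
      using subspace_neg[OF subspace_singular_chain_space[OF A]] Infty by force
  qed
qed

section \<open>Sums of root spaces\<close>

text \<open>
  Indices that carry the same point are merged, so that a sum over indices becomes a sum over
  distinct points.
\<close>

lemma sum_root_spaces_decompose:
  assumes A: "linear_relation smul A" and "finite I"
    and "x \<in> (\<Sum>i\<in>I. root_space smul A (lam i))"
  obtains z where "\<And>nu. z nu \<in> root_space smul A nu" "x = (\<Sum>nu\<in>lam ` I. z nu)"
proof -
  obtain f where f: "x = sum f I" "\<And>i. i \<in> I \<Longrightarrow> f i \<in> root_space smul A (lam i)"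
    using assms(3) unfolding set_sum_alt[OF \<open>finite I\<close>] by blast
  show ?thesis
  proof
    show "(\<Sum>i | i \<in> I \<and> lam i = nu. f i) \<in> root_space smul A nu" for nu
      using f(2) by (intro subspace_sum subspace_root_space A) auto
    show "x = (\<Sum>nu\<in>lam ` I. \<Sum>i | i \<in> I \<and> lam i = nu. f i)"
      using f(1) sum.image_gen[OF \<open>finite I\<close>, of f lam] by simp
  qed
qed

lemma singular_chain_subset_sum:
  assumes A: "linear_relation smul A" and "finite I" "I \<noteq> {}"
  shows "singular_chain_space smul A \<subseteq> (\<Sum>i\<in>I. root_space smul A (lam i))"
proof
  fix x assume x: "x \<in> singular_chain_space smul A"
  obtain k where k: "k \<in> I"
    using \<open>I \<noteq> {}\<close> by blast
  define f where "f i = (if i = k then x else 0)" for i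
  have "x = sum f I"
    using k \<open>finite I\<close> by (simp add: f_def)
  moreover have "f i \<in> root_space smul A (lam i)" for i
    using x singular_chain_subset_root[OF A] subspace_0[OF subspace_root_space[OF A]]
    by (auto simp: f_def)
  ultimately show "x \<in> (\<Sum>i\<in>I. root_space smul A (lam i))"
    unfolding set_sum_alt[OF \<open>finite I\<close>] by blast
qed

lemma sum_root_spaces_inter_subset:
  assumes A: "linear_relation smul A" and I: "finite I" and J: "finite J"
    and disj: "lam ` I \<inter> mu ` J = {}"
  shows "(\<Sum>i\<in>I. root_space smul A (lam i)) \<inter> (\<Sum>j\<in>J. root_space smul A (mu j))
    \<subseteq> singular_chain_space smul A"
proof
  fix x assume "x \<in> (\<Sum>i\<in>I. root_space smul A (lam i)) \<inter> (\<Sum>j\<in>J. root_space smul A (mu j))"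
  then have x_lam: "x \<in> (\<Sum>i\<in>I. root_space smul A (lam i))"
    and x_mu: "x \<in> (\<Sum>j\<in>J. root_space smul A (mu j))"
    by blast+
  obtain z where z: "\<And>nu. z nu \<in> root_space smul A nu" "x = (\<Sum>nu\<in>lam ` I. z nu)"
    using sum_root_spaces_decompose[OF A I x_lam] by blast
  obtain w where w: "\<And>nu. w nu \<in> root_space smul A nu" "x = (\<Sum>nu\<in>mu ` J. w nu)"
    using sum_root_spaces_decompose[OF A J x_mu] by blast
  define d where "d nu = (if nu \<in> lam ` I then z nu else - w nu)" for nu
  have d: "d nu \<in> root_space smul A nu" for nu
    using z(1) w(1) subspace_neg[OF subspace_root_space[OF A]] by (simp add: d_def)
  have sum_I: "(\<Sum>nu\<in>lam ` I. d nu) = x"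
    using z(2) by (simp add: d_def)
  have "(\<Sum>nu\<in>mu ` J. d nu) = (\<Sum>nu\<in>mu ` J. - w nu)"
    using disj by (intro sum.cong) (auto simp: d_def)
  then have "(\<Sum>nu\<in>lam ` I \<union> mu ` J. d nu) = 0"
    using I J disj sum_I w(2) by (simp add: sum.union_disjoint sum_negf)
  then have "d nu \<in> singular_chain_space smul A" if "nu \<in> lam ` I" for nu
    using root_vectors_sum_zero[OF A, of "lam ` I \<union> mu ` J" d nu] d I J that by simp
  then have "(\<Sum>nu\<in>lam ` I. d nu) \<in> singular_chain_space smul A"
    by (intro subspace_sum subspace_singular_chain_space A)
  then show "x \<in> singular_chain_space smul A"
    using sum_I by simp
qed

end

theorem corollary4p5:
  fixes smul :: "complex \<Rightarrow> 'a \<Rightarrow> 'a::ab_group_add"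
    and A :: "('a \<times> 'a) set"
    and l m :: nat
    and lam mu :: "nat \<Rightarrow> ext_complex"
  assumes "vector_space smul"
    and "linear_relation smul A"
    and "l \<ge> 1" and "m \<ge> 1"
    and "lam ` {1..l} \<inter> mu ` {1..m} = {}"
  shows "singular_chain_space smul A =
    (\<Sum>i = 1..l. root_space smul A (lam i)) \<inter> (\<Sum>j = 1..m. root_space smul A (mu j))"
proof -
  interpret complex_linear_space smul
    using assms(1) by (simp add: complex_linear_space_def)
  show ?thesis
  proof
    show "singular_chain_space smul A \<subseteq>
      (\<Sum>i = 1..l. root_space smul A (lam i)) \<inter> (\<Sum>j = 1..m. root_space smul A (mu j))"
      using assms(3,4) by (intro Int_greatest singular_chain_subset_sum[OF assms(2)]) auto
  qed (rule sum_root_spaces_inter_subset[OF assms(2) finite_atLeastAtMost finite_atLeastAtMost assms(5)])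
qed

end
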